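(* Let $A\in\mathbb{R}^{n\times n}$ be a symmetric positive definite matrix, let $b\in\mathbb{R}^n$, and let $x_*\in\mathbb{R}^n$ be the exact solution of $Ax=b$. Let $x_k\in\mathbb{R}^n$, put $r_k=b-Ax_k$, and let $1\le m\le n$. Let $\{i_1,i_2,\ldots,i_m\}$, with $i_1<i_2<\cdots<i_m$, be the set of indices of $m$ components of largest absolute value in $r_k$ (that is, $|(r_k)_i|\geq|(r_k)_j|$ for every $i\in\{i_1,\ldots,i_m\}$ and every $j\notin\{i_1,\ldots,i_m\}$). Let $v_j=e_{i_j}$ for $j=1,\ldots,m$, let $V_m=[v_1,\ldots,v_m]=[e_{i_1},\ldots,e_{i_m}]\in\mathbb{R}^{n\times m}$, and define $$x_{k+1}=x_k+V_m(V_m^TAV_m)^{-1}V_m^Tr_k .$$ Set $d_k=x_*-x_k$ and $d_{k+1}=x_*-x_{k+1}$. Then $$\|d_k\|_A^2-\|d_{k+1}\|_A^2\geq\frac{m}{n\,\lambda_{\max}(A)}\,\|r_k\|_2^2 .$$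
   Context: $e_i$ denotes the $i$th column of the $n\times n$ identity matrix, $\lambda_{\max}(A)$ denotes the largest eigenvalue of $A$, and $\|\cdot\|_2$ is the Euclidean norm. The $A$-norm is $\|x\|_A=\langle Ax,x\rangle^{1/2}=(x^TAx)^{1/2}$. *)

theory Defs
  imports "HOL-Analysis.Analysis"
begin

definition symmetric_matrix :: "real ^ 'n ^ 'n \<Rightarrow> bool" where
  "symmetric_matrix A \<longleftrightarrow> transpose A = A"

definition positive_definite :: "real ^ 'n ^ 'n \<Rightarrow> bool" where
  "positive_definite A \<longleftrightarrow> (\<forall>x. x \<noteq> 0 \<longrightarrow> 0 < x \<bullet> (A *v x))"

definition is_eigenvalue :: "real ^ 'n ^ 'n \<Rightarrow> real \<Rightarrow> bool" where
  "is_eigenvalue A l \<longleftrightarrow> (\<exists>v. v \<noteq> 0 \<and> A *v v = l *\<^sub>R v)"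

(* Only real eigenvalues are considered. This is intended for symmetric A, all of whose
   eigenvalues are real, so that the set below is finite and nonempty. *)
definition lambda_max :: "real ^ 'n ^ 'n \<Rightarrow> real" where
  "lambda_max A = Max {l. is_eigenvalue A l}"

definition A_norm :: "real ^ 'n ^ 'n \<Rightarrow> real ^ 'n \<Rightarrow> real" where
  "A_norm A x = sqrt ((A *v x) \<bullet> x)"

(* The index set of the m selected components is the range of i, where m = CARD('m). *)
definition largest_components :: "('m \<Rightarrow> 'n) \<Rightarrow> real ^ 'n \<Rightarrow> bool" where
  "largest_components i r \<longleftrightarrow> (\<forall>p \<in> range i. \<forall>q. q \<notin> range i \<longrightarrow> \<bar>r $ p\<bar> \<ge> \<bar>r $ q\<bar>)"

end

(* Writing M = V^T A V and g = V^T r, the error decrease equals <g, y> with M y = g, and y maximises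
   z -> 2 <g, z> - <M z, z>. Testing with z = g / lambda_max and using <M g, g> <= lambda_max |g|^2
   bounds the decrease below by |g|^2 / lambda_max, and since g collects the m largest components
   of r, it carries at least the fraction m / n of |r|^2. *)
theory Submission
  imports Defs
begin

lemma symmetric_matrix_inner:
  assumes "symmetric_matrix A"
  shows "(A *v x) \<bullet> y = x \<bullet> (A *v y)"
  using assms dot_lmul_matrix[of x A y] transpose_matrix_vector[of A x]
  unfolding symmetric_matrix_def by simp

lemma positive_definite_nonneg:
  assumes "positive_definite A"
  shows "0 \<le> x \<bullet> (A *v x)"
  using assms unfolding positive_definite_def by (cases "x = 0") (auto simp: less_imp_le)

lemma A_norm_power2:
  assumes "positive_definite A"
  shows "(A_norm A x)\<^sup>2 = x \<bullet> (A *v x)"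
  using positive_definite_nonneg[OF assms, of x] by (simp add: A_norm_def inner_commute)

text \<open>Moving from \<open>v\<close> against \<open>w = B *v v\<close> changes the form from 0
  to \<open>t * (t * c - 2 * s)\<close> with \<open>s = w \<bullet> w\<close>. For small positive
  \<open>t\<close> this is negative unless \<open>s = 0\<close>, so semidefiniteness forces
  \<open>w = 0\<close>.\<close>

lemma psd_form_zero_imp_ker:
  assumes sym: "symmetric_matrix B"
    and psd: "\<And>x. 0 \<le> x \<bullet> (B *v x)"
    and zero: "v \<bullet> (B *v v) = 0"
  shows "B *v v = 0"
proof -
  define w where "w = B *v v"
  define c where "c = w \<bullet> (B *v w)"
  define s where "s = w \<bullet> w"
  \<comment> \<open>The form is minimal at \<open>s / c\<close>; the shift to \<open>c + 1\<close>
    avoids a case split on \<open>c = 0\<close> and still gives a negative value when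
    \<open>s\<close> is positive.\<close>
  define t where "t = s / (c + 1)"
  have c: "0 \<le> c" using psd by (simp add: c_def)
  have s: "0 \<le> s" by (simp add: s_def)
  have vw: "v \<bullet> (B *v w) = s"
    using symmetric_matrix_inner[OF sym, of v w] by (simp add: w_def s_def)
  have wv: "w \<bullet> (B *v v) = s" by (simp add: w_def s_def)
  have "0 \<le> (v - t *\<^sub>R w) \<bullet> (B *v (v - t *\<^sub>R w))" by (rule psd)
  also have "\<dots> = t * (t * c - 2 * s)"
    using zero vw wv
    by (simp add: matrix_vector_mult_diff_distrib matrix_vector_mult_scaleR inner_diff_left
        inner_diff_right c_def[symmetric] algebra_simps)
  also have "t * c - 2 * s = - s * (c + 2) / (c + 1)"
    using c by (simp add: t_def divide_simps) (simp add: algebra_simps)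
  finally have "0 \<le> - (s\<^sup>2 * (c + 2) / (c + 1)\<^sup>2)"
    by (simp add: t_def power2_eq_square mult_ac)
  moreover have "0 < (c + 2) / (c + 1)\<^sup>2" using c by simp
  ultimately have "s\<^sup>2 * ((c + 2) / (c + 1)\<^sup>2) \<le> 0" by simp
  with \<open>0 < (c + 2) / (c + 1)\<^sup>2\<close> have "s\<^sup>2 \<le> 0"
    unfolding mult_le_0_iff by linarith
  then show ?thesis by (simp add: s_def w_def)
qed

text \<open>By compactness the form attains its maximum \<open>l\<close> over the unit sphere at
  some \<open>v\<close>. Then \<open>l I - A\<close> is positive semidefinite and its form vanishes
  at \<open>v\<close>, so \<open>v\<close> lies in its kernel and is an eigenvector for
  \<open>l\<close>.\<close>

lemma symmetric_max_eigenvalue: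
  fixes A :: "real ^ 'n ^ 'n"
  assumes sym: "symmetric_matrix A"
  obtains l where "is_eigenvalue A l" "\<And>x. x \<bullet> (A *v x) \<le> l * (x \<bullet> x)"
proof -
  let ?S = "sphere (0 :: real ^ 'n) 1"
  have ne: "?S \<noteq> {}" by simp
  have "continuous_on ?S (\<lambda>x. x \<bullet> (A *v x))"
    by (intro continuous_intros matrix_vector_mult_linear_continuous_on)
  from continuous_attains_sup[OF compact_sphere ne this]
  obtain v where v: "norm v = 1" and max: "\<And>x. norm x = 1 \<Longrightarrow> x \<bullet> (A *v x) \<le> v \<bullet> (A *v v)"
    by auto
  define l where "l = v \<bullet> (A *v v)"
  have bound: "x \<bullet> (A *v x) \<le> l * (x \<bullet> x)" for x
  proof (cases "x = 0")
    case False
    have "norm (x /\<^sub>R norm x) = 1" using False by simp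
    from max[OF this] have "(x \<bullet> (A *v x)) / (norm x)\<^sup>2 \<le> l"
      by (simp add: matrix_vector_mult_scaleR l_def divide_simps power2_eq_square)
    with False show ?thesis by (simp add: divide_simps dot_square_norm)
  qed simp
  define B where "B = l *\<^sub>R mat 1 - A"
  have B: "B *v x = l *\<^sub>R x - A *v x" for x
    by (simp add: B_def matrix_vector_mult_diff_rdistrib scaleR_matrix_vector_assoc[symmetric])
  have "transpose B = B"
    using sym by (simp add: symmetric_matrix_def B_def transpose_def mat_def vec_eq_iff)
  then have "B *v v = 0"
    using bound v
    by (intro psd_form_zero_imp_ker)
      (auto simp: symmetric_matrix_def B inner_diff_right l_def[symmetric] dot_square_norm)
  with v have "is_eigenvalue A l"
    unfolding is_eigenvalue_def B by (intro exI[of _ v]) auto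
  with bound show thesis by (rule that[rotated])
qed

text \<open>Eigenvectors of distinct eigenvalues are orthogonal, hence independent, and independent
  sets are finite here. This makes the \<open>Max\<close> in \<open>lambda_max\<close>
  meaningful.\<close>

lemma finite_eigenvalues:
  assumes sym: "symmetric_matrix A"
  shows "finite {l. is_eigenvalue A l}"
proof -
  let ?E = "{l. is_eigenvalue A l}"
  have "\<forall>l\<in>?E. \<exists>v. v \<noteq> 0 \<and> A *v v = l *\<^sub>R v"
    by (simp add: is_eigenvalue_def)
  from bchoice[OF this] obtain u
    where "\<forall>l\<in>?E. u l \<noteq> 0 \<and> A *v u l = l *\<^sub>R u l" ..
  then have u: "u l \<noteq> 0 \<and> A *v u l = l *\<^sub>R u l" if "l \<in> ?E" for l
    using that by (rule bspec)
  have orth: "u k \<bullet> u l = 0" if "k \<in> ?E" "l \<in> ?E" "k \<noteq> l" for k l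
  proof -
    have "k * (u k \<bullet> u l) = l * (u k \<bullet> u l)"
      using symmetric_matrix_inner[OF sym, of "u k" "u l"] u that by simp
    with \<open>k \<noteq> l\<close> show ?thesis by simp
  qed
  have "inj_on u ?E"
    using orth u by (metis inj_onI inner_eq_zero_iff)
  moreover have "pairwise orthogonal (u ` ?E)"
    using orth by (auto simp: pairwise_def orthogonal_def)
  then have "independent (u ` ?E)"
    using u by (intro pairwise_orthogonal_independent) auto
  then have "finite (u ` ?E)" by (rule independent_imp_finite)
  ultimately show ?thesis by (rule finite_imageD[rotated])
qed

lemma rayleigh_le_lambda_max:
  assumes sym: "symmetric_matrix A"
  shows "x \<bullet> (A *v x) \<le> lambda_max A * (x \<bullet> x)"
proof -
  obtain l where l: "is_eigenvalue A l" and le: "\<And>x. x \<bullet> (A *v x) \<le> l * (x \<bullet> x)"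
    using symmetric_max_eigenvalue[OF sym] by blast
  have "l \<le> lambda_max A"
    using l finite_eigenvalues[OF sym] by (simp add: lambda_max_def)
  then have "l * (x \<bullet> x) \<le> lambda_max A * (x \<bullet> x)"
    by (intro mult_right_mono) auto
  with le[of x] show ?thesis by linarith
qed

lemma lambda_max_pos:
  fixes A :: "real ^ 'n ^ 'n"
  assumes "symmetric_matrix A" "positive_definite A"
  shows "0 < lambda_max A"
proof -
  \<comment> \<open>The all-ones vector serves as a concrete nonzero test vector.\<close>
  let ?x = "1 :: real ^ 'n"
  have "?x \<noteq> 0" by simp
  then have "0 < ?x \<bullet> (A *v ?x)"
    using assms(2) unfolding positive_definite_def by blast
  also have "\<dots> \<le> lambda_max A * (?x \<bullet> ?x)"
    using assms(1) by (rule rayleigh_le_lambda_max)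
  finally show ?thesis
    using inner_ge_zero[of ?x] unfolding zero_less_mult_iff by linarith
qed

text \<open>Summing \<open>f q \<le> f p\<close> over all pairs with \<open>p\<close> inside and
  \<open>q\<close> outside \<open>S\<close> compares the two partial sums; adding
  \<open>card S * sum f S\<close> to both sides gives the claim.\<close>

lemma card_mult_sum_le_of_dominating:
  fixes f :: "'a :: finite \<Rightarrow> real"
  assumes dom: "\<And>p q. p \<in> S \<Longrightarrow> q \<notin> S \<Longrightarrow> f q \<le> f p"
  shows "real (card S) * sum f UNIV \<le> real CARD('a) * sum f S"
proof -
  have "card S * sum f (-S) = (\<Sum>p\<in>S. \<Sum>q\<in>-S. f q)" by simp
  also have "\<dots> \<le> (\<Sum>p\<in>S. \<Sum>q\<in>-S. f p)"
    using dom by (intro sum_mono) auto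
  also have "\<dots> = card (-S) * sum f S" by (simp add: sum_distrib_left)
  finally have "card S * sum f (-S) \<le> card (-S) * sum f S" .
  moreover have "sum f UNIV = sum f S + sum f (-S)"
    using sum.union_disjoint[of S "-S" f] by simp
  moreover have "CARD('a) = card S + card (-S)"
    using card_Un_disjoint[of S "-S"] by simp
  ultimately show ?thesis by (simp add: algebra_simps)
qed

text \<open>Completing the square: the right side minus the left side is the form of
  \<open>M\<close> at \<open>z - y\<close>.\<close>

lemma quadratic_le_at_solution:
  assumes sym: "symmetric_matrix M" and psd: "\<And>x. 0 \<le> x \<bullet> (M *v x)"
    and sol: "M *v y = g"
  shows "2 * (g \<bullet> z) - z \<bullet> (M *v z) \<le> g \<bullet> y"
proof -
  have "y \<bullet> (M *v z) = g \<bullet> z"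
    using symmetric_matrix_inner[OF sym, of y z] sol by simp
  then show ?thesis
    using psd[of "z - y"] sol
    by (simp add: matrix_vector_mult_diff_distrib inner_diff_left inner_diff_right inner_commute)
qed

theorem theorem3:
  fixes A :: "real ^ ('n::{finite,linorder}) ^ ('n::{finite,linorder})"
    and b x_star x_k x_k1 r_k d_k d_k1 :: "real ^ ('n::{finite,linorder})"
    and i :: "'m::{finite,linorder} \<Rightarrow> 'n::{finite,linorder}"
    and v :: "'m::{finite,linorder} \<Rightarrow> real ^ ('n::{finite,linorder})"
    and V :: "real ^ ('m::{finite,linorder}) ^ ('n::{finite,linorder})"
  assumes "symmetric_matrix A"
    and "positive_definite A"
    and "A *v x_star = b"
    and "r_k = b - A *v x_k"
    and "1 \<le> CARD('m)" and "CARD('m) \<le> CARD('n)"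
    and "strict_mono i"
    and "largest_components i r_k"
    and "\<And>j. v j = axis (i j) 1"
    and "\<And>j. column j V = v j"
    and "x_k1 = x_k + V *v (matrix_inv (transpose V ** A ** V) *v (transpose V *v r_k))"
    and "d_k = x_star - x_k"
    and "d_k1 = x_star - x_k1"
  shows "(A_norm A d_k)\<^sup>2 - (A_norm A d_k1)\<^sup>2
           \<ge> real CARD('m) / (real CARD('n) * lambda_max A) * (norm r_k)\<^sup>2"
proof -
  note sym = assms(1) and pd = assms(2)
  \<comment> \<open>As a simp rule this would turn \<open>transpose V *v x\<close> into
    \<open>x v* V\<close>, away from the shape of the facts on \<open>V\<close> below.\<close>
  note transpose_matrix_vector [simp del]
  define M where "M = transpose V ** A ** V"
  define g where "g = transpose V *v r_k"
  define y where "y = matrix_inv M *v g"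
  define L where "L = lambda_max A"
  have inj: "inj i" using assms(7) by (rule strict_mono_imp_inj_on)
  have V: "V $ p $ j = (if p = i j then 1 else 0)" for p j
    using assms(9)[of j] assms(10)[of j] by (auto simp: column_def vec_eq_iff axis_def)
  have Vt: "(transpose V *v x) $ j = x $ i j" for x j
    by (simp add: matrix_vector_mult_def transpose_def V if_distrib[of "\<lambda>a. a * _"] cong: if_cong)
  \<comment> \<open>The columns of \<open>V\<close> are orthonormal, since injectivity of
    \<open>i\<close> makes them distinct unit vectors.\<close>
  have VtV: "transpose V *v (V *v z) = z" for z
  proof -
    have "(V *v z) $ i j = z $ j" for j
      using inj
      by (simp add: matrix_vector_mult_def V inj_eq if_distrib[of "\<lambda>a. a * _"] cong: if_cong)
    then show ?thesis unfolding vec_eq_iff Vt by blast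
  qed
  have adj: "(V *v z) \<bullet> x = z \<bullet> (transpose V *v x)" for z x
    using dot_lmul_matrix[of z "transpose V" x] transpose_matrix_vector[of "transpose V" z] by simp
  have M: "M *v z = transpose V *v (A *v (V *v z))" for z
    by (simp add: M_def matrix_vector_mul_assoc matrix_mul_assoc)
  have form: "z \<bullet> (M *v z) = (V *v z) \<bullet> (A *v (V *v z))" for z
    by (simp add: M adj)
  have M_psd: "0 \<le> z \<bullet> (M *v z)" for z
    unfolding form using pd by (rule positive_definite_nonneg)
  have M_sym: "symmetric_matrix M"
    using sym
    by (simp add: symmetric_matrix_def M_def matrix_transpose_mul matrix_mul_assoc transpose_transpose)
  \<comment> \<open>\<open>V\<close> has the left inverse \<open>transpose V\<close>, so
    definiteness of \<open>A\<close> passes to \<open>M\<close> and its kernel is trivial.\<close>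
  have "z = 0" if "M *v z = 0" for z
  proof -
    have "(V *v z) \<bullet> (A *v (V *v z)) = 0" using that form[of z] by simp
    then have "V *v z = 0" using pd unfolding positive_definite_def by force
    then show ?thesis using VtV[of z] by simp
  qed
  then have inv_M: "invertible M"
    by (auto simp: invertible_left_inverse matrix_left_invertible_ker)
  have "M ** matrix_inv M = mat 1"
    \<comment> \<open>\<open>matrix_inv\<close> is a Hilbert choice; invertibility ensures that the
      chosen matrix is a genuine inverse.\<close>
    using inv_M unfolding invertible_def matrix_inv_def by (rule someI_ex[THEN conjunct1])
  then have My: "M *v y = g"
    by (simp add: y_def matrix_vector_mul_assoc)
  have Ad: "A *v d_k = r_k"
    using assms(3,4,12) by (simp add: matrix_vector_mult_diff_distrib)
  have d1: "d_k1 = d_k - V *v y"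
    using assms(11-13) by (simp add: y_def g_def M_def)
  have "d_k \<bullet> (A *v (V *v y)) = (V *v y) \<bullet> r_k"
    using symmetric_matrix_inner[OF sym, of d_k "V *v y"] Ad by (simp add: inner_commute)
  \<comment> \<open>Expanding the form at \<open>d_k - V *v y\<close> leaves
    \<open>2 * (g \<bullet> y) - y \<bullet> (M *v y)\<close>, and \<open>M *v y = g\<close> merges
    the two terms.\<close>
  then have decrease: "(A_norm A d_k)\<^sup>2 - (A_norm A d_k1)\<^sup>2 = g \<bullet> y"
    using My form[of y] adj[of y r_k] Ad
    by (simp add: A_norm_power2[OF pd] d1 matrix_vector_mult_diff_distrib inner_diff_left
        inner_diff_right g_def[symmetric] inner_commute)
  have L: "0 < L" using lambda_max_pos[OF sym pd] by (simp add: L_def)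
  have "g \<bullet> (M *v g) \<le> L * ((V *v g) \<bullet> (V *v g))"
    unfolding form L_def using sym by (rule rayleigh_le_lambda_max)
  \<comment> \<open>\<open>V\<close> is an isometry, so the Rayleigh bound for \<open>A\<close>
    carries over to \<open>M\<close> with the same constant.\<close>
  also have "(V *v g) \<bullet> (V *v g) = g \<bullet> g" by (simp add: adj VtV)
  finally have gMg: "g \<bullet> (M *v g) \<le> L * (g \<bullet> g)" .
  \<comment> \<open>The point \<open>g /\<^sub>R L\<close> maximises
    \<open>2 * (g \<bullet> z) - L * (z \<bullet> z)\<close>, and \<open>(g \<bullet> g) / L\<close>
    is the value there.\<close>
  have "(g \<bullet> g) / L = 2 * (g \<bullet> g) / L - L * (g \<bullet> g) / L\<^sup>2"
    using L by (simp add: power2_eq_square)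
  also have "\<dots> \<le> 2 * (g \<bullet> g) / L - g \<bullet> (M *v g) / L\<^sup>2"
    using gMg by (intro diff_left_mono divide_right_mono) auto
  also have "\<dots> = 2 * (g \<bullet> (g /\<^sub>R L)) - (g /\<^sub>R L) \<bullet> (M *v (g /\<^sub>R L))"
    by (simp add: matrix_vector_mult_scaleR divide_inverse power2_eq_square mult_ac)
  also have "\<dots> \<le> g \<bullet> y"
    using M_sym M_psd My by (rule quadratic_le_at_solution)
  finally have lower: "(g \<bullet> g) / L \<le> g \<bullet> y" .
  \<comment> \<open>The counting lemma is applied to the squared components of \<open>r_k\<close>;
    those indexed by \<open>range i\<close> sum to \<open>g \<bullet> g\<close>, and injectivity of
    \<open>i\<close> gives \<open>range i\<close> exactly \<open>CARD('m)\<close> elements.\<close>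
  have "(r_k $ q)\<^sup>2 \<le> (r_k $ p)\<^sup>2" if "p \<in> range i" "q \<notin> range i" for p q
    using assms(8) that unfolding largest_components_def by (metis abs_le_square_iff)
  then have "card (range i) * (\<Sum>p\<in>UNIV. (r_k $ p)\<^sup>2) \<le> CARD('n) * (\<Sum>p\<in>range i. (r_k $ p)\<^sup>2)"
    by (rule card_mult_sum_le_of_dominating)
  moreover have "(\<Sum>p\<in>range i. (r_k $ p)\<^sup>2) = g \<bullet> g"
    using inj by (simp add: sum.reindex inner_vec_def g_def Vt power2_eq_square)
  moreover have "(\<Sum>p\<in>UNIV. (r_k $ p)\<^sup>2) = (norm r_k)\<^sup>2"
    unfolding dot_square_norm[symmetric] by (simp add: inner_vec_def power2_eq_square)
  ultimately have "CARD('m) * (norm r_k)\<^sup>2 \<le> CARD('n) * (g \<bullet> g)"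
    using inj by (simp add: card_image)
  then have "real CARD('m) / (real CARD('n) * L) * (norm r_k)\<^sup>2 \<le> (g \<bullet> g) / L"
    using L by (simp add: divide_simps mult_ac)
  with lower decrease show ?thesis by (simp add: L_def)
qed

end
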